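(* Let $h_1,h_2,l_1,\alpha_1,\lambda\in\mathbb{C}$ and $t_1,t_2\in\mathbb{C}\setminus\{0\}$. Consider the equation of type $(1,2)$: $$\text{(A)}\quad q^{h_1+h_2-l_1-2\lambda+1/2}t_2(q^{l_1-1/2}t_1-x)g(qx)+(x-q^{h_1+1/2}t_1)(x-q^{h_2+1/2}t_2)g(x/q)$$ $$-\big[q^{\alpha_1}x^2-q^{h_1+h_2-\lambda+1/2}(q^{-h_2}t_1+q^{-h_1}t_2+q^{-l_1}t_2)x+q^{h_1+h_2-\lambda}(q+1)t_1t_2\big]g(x)=0,$$ and the equation of type $(2,1)$: $$\text{(B)}\quad(x-q^{\tilde l_1-1/2}t_1)(x-q^{\tilde l_2-1/2}t_2)g(qx)-q^{-\tilde h_1+\tilde l_1+\tilde l_2+2\lambda-1/2}t_2(x-q^{\tilde h_1+1/2}t_1)g(x/q)$$ $$-\big[q^{-\tilde\alpha_1}x^2-q^{\tilde l_1+\tilde l_2+\lambda-1/2}\{q^{-\tilde l_2}t_1+(q^{-\tilde h_1}+q^{-\tilde l_1})t_2\}x+q^{\tilde l_1+\tilde l_2+\lambda}(1+q^{-1})t_1t_2\big]g(x)=0,$$ where $$\tilde l_1=l_1,\quad\tilde l_2=h_2,\quad\tilde h_1=h_1,\quad\tilde\alpha_1+\alpha_1=h_1-l_1+1-2\lambda.$$ If a function $y(x)$ satisfies (A), then $u(x)=(q^{-h_2+1/2}t_2^{-1}x;q)_\infty\,y(x)$ is a solution of (B). Conversely, if a function $u(x)$ satisfies (B), then $y(x)=u(x)/(q^{-\tilde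 l_2+1/2}t_2^{-1}x;q)_\infty$ satisfies (A), with the same relationship among the parameters.
   Context: Here $q\in\mathbb{C}$ with $0<|q|<1$, with a fixed choice of $\log q$ and $q^a=\exp(a\log q)$; $(z;q)_\infty=\prod_{i=0}^\infty(1-q^iz)$. Functions are complex-valued functions of $x$ on a set stable under multiplication by $q^{\pm1}$; a function satisfies an equation if the identity holds with $g$ replaced by it. In the converse direction the identity is understood where the infinite products occurring in denominators do not vanish (or as an identity of meromorphic functions). *)

theory Defs
  imports "HOL-Analysis.Infinite_Products"
begin

text \<open>The power \<open>q\<^sup>a = exp (a log q)\<close> depends on the fixed choice \<open>L\<close> of \<open>log q\<close>, which need not be
  the principal branch; this is why \<open>powr\<close> is not used.\<close>

definition qpow :: "complex \<Rightarrow> complex \<Rightarrow> complex" where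
  "qpow L a = exp (a * L)"

definition qpoch_inf :: "complex \<Rightarrow> complex \<Rightarrow> complex" where
  "qpoch_inf z q = (\<Prod>i. 1 - q ^ i * z)"

definition q_stable :: "complex \<Rightarrow> complex set \<Rightarrow> bool" where
  "q_stable q S \<longleftrightarrow> (\<forall>x\<in>S. q * x \<in> S \<and> x / q \<in> S)"

text \<open>Left-hand sides of the \<open>q\<close>-difference equations of type \<open>(1,2)\<close> and \<open>(2,1)\<close> for the function \<open>g\<close> at
  the point \<open>x\<close>. Throughout, \<open>q = exp L\<close> is intended.\<close>

definition lhs12 ::
  "complex \<Rightarrow> complex \<Rightarrow> complex \<Rightarrow> complex \<Rightarrow> complex \<Rightarrow> complex \<Rightarrow> complex \<Rightarrow> complex \<Rightarrow> complex
    \<Rightarrow> (complex \<Rightarrow> complex) \<Rightarrow> complex \<Rightarrow> complex" where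
  "lhs12 q L h1 h2 l1 \<alpha>1 lam t1 t2 g x =
     qpow L (h1 + h2 - l1 - 2 * lam + 1/2) * t2 * (qpow L (l1 - 1/2) * t1 - x) * g (q * x)
     + (x - qpow L (h1 + 1/2) * t1) * (x - qpow L (h2 + 1/2) * t2) * g (x / q)
     - (qpow L \<alpha>1 * x\<^sup>2
        - qpow L (h1 + h2 - lam + 1/2)
          * (qpow L (- h2) * t1 + qpow L (- h1) * t2 + qpow L (- l1) * t2) * x
        + qpow L (h1 + h2 - lam) * (q + 1) * t1 * t2) * g x"

definition lhs21 ::
  "complex \<Rightarrow> complex \<Rightarrow> complex \<Rightarrow> complex \<Rightarrow> complex \<Rightarrow> complex \<Rightarrow> complex \<Rightarrow> complex \<Rightarrow> complex
    \<Rightarrow> (complex \<Rightarrow> complex) \<Rightarrow> complex \<Rightarrow> complex" where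
  "lhs21 q L h1 l1 l2 \<alpha>1 lam t1 t2 g x =
     (x - qpow L (l1 - 1/2) * t1) * (x - qpow L (l2 - 1/2) * t2) * g (q * x)
     - qpow L (- h1 + l1 + l2 + 2 * lam - 1/2) * t2 * (x - qpow L (h1 + 1/2) * t1) * g (x / q)
     - (qpow L (- \<alpha>1) * x\<^sup>2
        - qpow L (l1 + l2 + lam - 1/2)
          * (qpow L (- l2) * t1 + (qpow L (- h1) + qpow L (- l1)) * t2) * x
        + qpow L (l1 + l2 + lam) * (1 + inverse q) * t1 * t2) * g x"

text \<open>Functions are represented by total functions; only their values on the \<open>q\<close>-stable set \<open>S\<close> matter.\<close>

definition satisfies12 where
  "satisfies12 q L h1 h2 l1 \<alpha>1 lam t1 t2 S g \<longleftrightarrow>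
     (\<forall>x\<in>S. lhs12 q L h1 h2 l1 \<alpha>1 lam t1 t2 g x = 0)"

definition satisfies21 where
  "satisfies21 q L h1 l1 l2 \<alpha>1 lam t1 t2 S g \<longleftrightarrow>
     (\<forall>x\<in>S. lhs21 q L h1 l1 l2 \<alpha>1 lam t1 t2 g x = 0)"

text \<open>The points at which none of the denominators \<open>P (q x)\<close>, \<open>P x\<close>, \<open>P (x / q)\<close> entering a
  \<open>q\<close>-difference equation for \<open>u / P\<close> vanishes.\<close>

definition nonvanishing_pts :: "complex \<Rightarrow> (complex \<Rightarrow> complex) \<Rightarrow> complex set \<Rightarrow> complex set" where
  "nonvanishing_pts q P S = {x \<in> S. P (q * x) \<noteq> 0 \<and> P x \<noteq> 0 \<and> P (x / q) \<noteq> 0}"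

end

(* Let P(x) = (q^(-h2+1/2) x / t2; q)_oo. The functional equation (z; q)_oo = (1 - z) (q z; q)_oo turns the
   factor x - q^(h2+1/2) t2 in front of y(x/q) into the quotient P(x/q) / P(x), up to a constant, and creates
   the factor x - q^(h2-1/2) t2 in front of u(q x). Hence P(x) times the left-hand side of (A) for y is
   q^(h1-l1+1-2 lam) times the left-hand side of (B) for P y, which gives both directions. *)
theory Submission
  imports Defs
begin

text \<open>Splitting off the factor \<open>i = 0\<close> from the partial products for
  \<open>z\<close> leaves those for \<open>q * z\<close>, so both sides are limits of the same
  sequence. The limits exist by comparison with a geometric series, also when some factor is
  zero.\<close>

lemma qpoch_inf_step:
  assumes "norm q < 1"
  shows "qpoch_inf z q = (1 - z) * qpoch_inf (q * z) q"
proof -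
  have lim: "(\<lambda>n. \<Prod>i\<le>n. 1 - q ^ i * w) \<longlonglongrightarrow> qpoch_inf w q" for w
  proof -
    have "summable (\<lambda>i. norm (q ^ i * w))"
      using assms by (simp add: norm_mult norm_power summable_geometric summable_mult2)
    then have "abs_convergent_prod (\<lambda>i. 1 - q ^ i * w)"
      by (intro summable_imp_abs_convergent_prod) simp
    then show ?thesis
      unfolding qpoch_inf_def
      by (intro convergent_prod_LIMSEQ abs_convergent_prod_imp_convergent_prod)
  qed
  have "(\<Prod>i\<le>Suc n. 1 - q ^ i * z) = (1 - z) * (\<Prod>i\<le>n. 1 - q ^ i * (q * z))" for n
    by (simp add: prod.atMost_Suc_shift mult_ac del: prod.atMost_Suc)
  then have "(\<lambda>n. \<Prod>i\<le>Suc n. 1 - q ^ i * z) \<longlonglongrightarrow> (1 - z) * qpoch_inf (q * z) q"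
    using tendsto_mult[OF tendsto_const lim[of "q * z"]] by simp
  moreover have "(\<lambda>n. \<Prod>i\<le>Suc n. 1 - q ^ i * z) \<longlonglongrightarrow> qpoch_inf z q"
    using lim by (rule LIMSEQ_Suc)
  ultimately show ?thesis
    by (rule LIMSEQ_unique[rotated])
qed

lemma qpow_add: "qpow L (a + b) = qpow L a * qpow L b"
  by (simp add: qpow_def algebra_simps exp_add)

lemma qpow_minus: "qpow L (- a) = inverse (qpow L a)"
  by (simp add: qpow_def exp_minus)

lemma qpow_diff: "qpow L (a - b) = qpow L a / qpow L b"
  by (simp add: qpow_def left_diff_distrib exp_diff)

lemma qpow_nonzero [simp]: "qpow L a \<noteq> 0"
  by (simp add: qpow_def)

text \<open>A pointwise identity for arbitrary \<open>y\<close>, with a nonzero constant on the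
  right, so that it can be read in both directions. The terms in \<open>y (q * x)\<close>,
  \<open>y (x / q)\<close> and \<open>y x\<close> are matched separately.\<close>

lemma lhs12_gauge:
  fixes q L h1 h2 l1 \<alpha>1 \<alpha>1' lam t1 t2 :: complex
  defines "P \<equiv> \<lambda>x. qpoch_inf (qpow L (- h2 + 1/2) * inverse t2 * x) q"
  assumes "norm q < 1" and "exp L = q" and "t2 \<noteq> 0"
    and \<alpha>: "\<alpha>1' + \<alpha>1 = h1 - l1 + 1 - 2 * lam"
  shows "P x * lhs12 q L h1 h2 l1 \<alpha>1 lam t1 t2 y x
    = qpow L (h1 - l1 + 1 - 2 * lam) * lhs21 q L h1 l1 h2 \<alpha>1' lam t1 t2 (\<lambda>x. P x * y x) x"
proof -
  \<comment> \<open>\<open>s\<close> is the square root of \<open>q\<close> fixed by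
    \<open>L\<close>. In terms of \<open>s\<close> and the letters below, every power of
    \<open>q\<close> is a Laurent monomial, so the claims become identities of rational
    functions.\<close>
  define s where "s = qpow L (1/2)"
  define H1 H2 L1 M A where "H1 = qpow L h1" and "H2 = qpow L h2" and "L1 = qpow L l1"
    and "M = qpow L lam" and "A = qpow L \<alpha>1'"
  note folds = s_def H1_def H2_def L1_def M_def A_def
  have nz: "s \<noteq> 0" "H1 \<noteq> 0" "H2 \<noteq> 0" "L1 \<noteq> 0" "M \<noteq> 0" "A \<noteq> 0"
    by (simp_all add: folds)
  have one: "qpow L 1 = s * s"
    unfolding s_def qpow_add[symmetric] by simp
  have q: "q = s * s"
    using \<open>exp L = q\<close> one by (simp add: qpow_def)
  have M2: "qpow L (2 * lam) = M * M"
    unfolding M_def qpow_add[symmetric] by simp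
  \<comment> \<open>The relation between the parameters eliminates \<open>\<alpha>1\<close>; it is
    what makes the coefficients of \<open>x\<^sup>2\<close> agree in \<open>middle\<close>.\<close>
  have "qpow L \<alpha>1 = qpow L (h1 - l1 + 1 - 2 * lam - \<alpha>1')"
    using \<alpha> by (metis add_diff_cancel_left')
  then have A1: "qpow L \<alpha>1 = H1 * s * s / (L1 * M * M * A)"
    by (simp add: qpow_add qpow_diff one M2 folds mult.assoc)
  have P_eq: "P z = qpoch_inf (s / H2 * inverse t2 * z) q" for z
    unfolding P_def qpow_add qpow_minus folds by (simp add: field_simps)
  have P: "P z = (1 - s * z / (H2 * t2)) * P (q * z)" for z
    using qpoch_inf_step[OF \<open>norm q < 1\<close>, of "s / H2 * inverse t2 * z"]
    by (simp add: P_eq divide_inverse mult_ac)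
  have Pq: "P x = (1 - s * x / (H2 * t2)) * P (q * x)"
    by (rule P)
  have "q \<noteq> 0"
    using nz q by simp
  then have Px: "P (x / q) = (1 - x / (s * H2 * t2)) * P x"
    using P[of "x / q"] nz by (simp add: q field_simps)
  \<comment> \<open>Here \<open>1 - s * x / (H2 * t2)\<close> equals \<open>- s / (H2 * t2)\<close>
    times \<open>x - qpow L (h2 - 1/2) * t2\<close>; its sign turns
    \<open>qpow L (l1 - 1/2) * t1 - x\<close> around.\<close>
  have up: "P x * (qpow L (h1 + h2 - l1 - 2 * lam + 1/2) * t2 * (qpow L (l1 - 1/2) * t1 - x) * y (q * x))
    = qpow L (h1 - l1 + 1 - 2 * lam) * ((x - qpow L (l1 - 1/2) * t1) * (x - qpow L (h2 - 1/2) * t2)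
        * (P (q * x) * y (q * x)))"
    unfolding Pq using nz \<open>t2 \<noteq> 0\<close>
    by (simp only: qpow_add qpow_diff qpow_minus one M2 flip: folds) (simp add: field_simps)
  \<comment> \<open>The factor \<open>x - qpow L (h2 + 1/2) * t2\<close> is
    \<open>- s * H2 * t2\<close> times \<open>P (x / q) / P x\<close> wherever \<open>P x\<close> is
    nonzero, which gives the minus sign.\<close>
  have down: "P x * ((x - qpow L (h1 + 1/2) * t1) * (x - qpow L (h2 + 1/2) * t2) * y (x / q))
    = - (qpow L (h1 - l1 + 1 - 2 * lam) * (qpow L (- h1 + l1 + h2 + 2 * lam - 1/2) * t2
        * (x - qpow L (h1 + 1/2) * t1) * (P (x / q) * y (x / q))))"
    unfolding Px using nz \<open>t2 \<noteq> 0\<close>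
    by (simp only: qpow_add qpow_diff qpow_minus one M2 flip: folds) (simp add: field_simps)
  have middle: "qpow L \<alpha>1 * x\<^sup>2
        - qpow L (h1 + h2 - lam + 1/2)
          * (qpow L (- h2) * t1 + qpow L (- h1) * t2 + qpow L (- l1) * t2) * x
        + qpow L (h1 + h2 - lam) * (q + 1) * t1 * t2
    = qpow L (h1 - l1 + 1 - 2 * lam) * (qpow L (- \<alpha>1') * x\<^sup>2
        - qpow L (l1 + h2 + lam - 1/2)
          * (qpow L (- h2) * t1 + (qpow L (- h1) + qpow L (- l1)) * t2) * x
        + qpow L (l1 + h2 + lam) * (1 + inverse q) * t1 * t2)"
    using nz
    by (simp only: qpow_add qpow_diff qpow_minus one M2 A1 q flip: folds)
      (simp add: field_simps power2_eq_square)
  show ?thesis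
    using up down unfolding lhs12_def lhs21_def middle by algebra
qed

theorem proposition6p2:
  fixes q L h1 h2 l1 \<alpha>1 lam t1 t2 :: complex
    and h1' l1' l2' \<alpha>1' :: complex
    and S :: "complex set"
  assumes "0 < norm q" and "norm q < 1" and "exp L = q"
    and "t1 \<noteq> 0" and "t2 \<noteq> 0"
    and "q_stable q S"
    and "l1' = l1" and "l2' = h2" and "h1' = h1"
    and "\<alpha>1' + \<alpha>1 = h1 - l1 + 1 - 2 * lam"
  shows "(\<forall>y :: complex \<Rightarrow> complex.
            satisfies12 q L h1 h2 l1 \<alpha>1 lam t1 t2 S y \<longrightarrow>
            satisfies21 q L h1' l1' l2' \<alpha>1' lam t1 t2 S
              (\<lambda>x. qpoch_inf (qpow L (- h2 + 1/2) * inverse t2 * x) q * y x)) \<and>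
         (\<forall>u :: complex \<Rightarrow> complex.
            satisfies21 q L h1' l1' l2' \<alpha>1' lam t1 t2 S u \<longrightarrow>
            satisfies12 q L h1 h2 l1 \<alpha>1 lam t1 t2
              (nonvanishing_pts q (\<lambda>x. qpoch_inf (qpow L (- l2' + 1/2) * inverse t2 * x) q) S)
              (\<lambda>x. u x / qpoch_inf (qpow L (- l2' + 1/2) * inverse t2 * x) q))"
proof -
  define P where "P x = qpoch_inf (qpow L (- h2 + 1/2) * inverse t2 * x) q" for x
  note gauge = lhs12_gauge[OF assms(2,3,5,10), where ?h2.0 = h2 and ?t1.0 = t1, folded P_def]
  have "satisfies21 q L h1 l1 h2 \<alpha>1' lam t1 t2 S (\<lambda>x. P x * y x)"
    if "satisfies12 q L h1 h2 l1 \<alpha>1 lam t1 t2 S y" for y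
    unfolding satisfies21_def
  proof
    fix x assume "x \<in> S"
    then have "lhs12 q L h1 h2 l1 \<alpha>1 lam t1 t2 y x = 0"
      using that by (simp add: satisfies12_def)
    \<comment> \<open>Only the nonzero constant is cancelled, so zeros of \<open>P\<close> do no
      harm.\<close>
    then show "lhs21 q L h1 l1 h2 \<alpha>1' lam t1 t2 (\<lambda>x. P x * y x) x = 0"
      using gauge[where x = x and y = y] by simp
  qed
  moreover have "satisfies12 q L h1 h2 l1 \<alpha>1 lam t1 t2 (nonvanishing_pts q P S) (\<lambda>x. u x / P x)"
    if "satisfies21 q L h1 l1 h2 \<alpha>1' lam t1 t2 S u" for u
    unfolding satisfies12_def
  proof
    fix x assume "x \<in> nonvanishing_pts q P S"
    then have "x \<in> S" and nz: "P (q * x) \<noteq> 0" "P x \<noteq> 0" "P (x / q) \<noteq> 0"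
      by (auto simp: nonvanishing_pts_def)
    \<comment> \<open>\<open>P\<close> cancels at \<open>q * x\<close>, \<open>x\<close> and
      \<open>x / q\<close>, the three points where it is known not to vanish.\<close>
    have "lhs21 q L h1 l1 h2 \<alpha>1' lam t1 t2 (\<lambda>x. P x * (u x / P x)) x
        = lhs21 q L h1 l1 h2 \<alpha>1' lam t1 t2 u x"
      using nz by (simp add: lhs21_def)
    also have "\<dots> = 0"
      using that \<open>x \<in> S\<close> by (simp add: satisfies21_def)
    finally show "lhs12 q L h1 h2 l1 \<alpha>1 lam t1 t2 (\<lambda>x. u x / P x) x = 0"
      using gauge[where x = x and y = "\<lambda>x. u x / P x"] nz by simp
  qed
  ultimately show ?thesis
    unfolding assms(7-9) P_def by blast
qed

end
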